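(* Let $\varepsilon(\cdot)=\big(\varepsilon_{ij}^p(\cdot):p\in\mathcal{P}_{ij},(i,j)\in\mathcal{W}\big):\Lambda\to\mathbb{R}_+^{|\mathcal{P}|}$ be given, and define for $h\in\Lambda$, $(i,j)\in\mathcal{W}$, $p\in\mathcal{P}_{ij}$, $t\in[t_0,t_f]$ $$\Phi_p^{\varepsilon}(t,h)=\max\left\{\Psi_p(t,h),\ v_{ij}(h)+\varepsilon_{ij}^p(h)\right\}-\left(\varepsilon_{ij}^p(h)-\min_{q\in\mathcal{P}_{ij}}\varepsilon_{ij}^q(h)\right).$$ Then $h^*\in\Lambda$ is a VT-BR-DUE associated with $\varepsilon(\cdot)$ if and only if $$\sum_{p\in\mathcal{P}}\int_{t_0}^{t_f}\Phi_p^{\varepsilon}(t,h^* )\,\big(h_p(t)-h_p^*(t)\big)\,dt\ \ge\ 0\qquad\text{for all } h\in\Lambda .$$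
   Context: $[t_0,t_f]\subset\mathbb{R}$ is a compact time interval; $\mathcal{W}$ is a finite set of origin-destination (O-D) pairs; $\mathcal{P}$ is the finite set of paths, the disjoint union of the nonempty sets $\mathcal{P}_{ij}$ of paths connecting $(i,j)\in\mathcal{W}$. $\mathbb{R}_+$ (resp. $\mathbb{R}_{++}$) denotes the nonnegative (resp. positive) reals; $L^2_+[t_0,t_f]$ is the set of nonnegative functions in $L^2[t_0,t_f]$. For given demands $Q_{ij}\in\mathbb{R}_{++}$, the feasible set is $$\Lambda=\Big\{h=(h_p)_{p\in\mathcal{P}}\in\big(L_+^2[t_0,t_f]\big)^{|\mathcal{P}|}:\ \sum_{p\in\mathcal{P}_{ij}}\int_{t_0}^{t_f}h_p(t)\,dt=Q_{ij}\ \ \forall (i,j)\in\mathcal{W}\Big\}.$$ The path delay operator assigns to each $h$ the vector of path travel times $D(h)=(D_p(\cdot,h))_{p\in\mathcal{P}}\in(L^2_+[t_0,t_f])^{|\mathcal{P}|}$. The effective path delay operator $\Psi$ assigns to $h$ the vector $\Psi(h)=(\Psi_p(\cdot,h))_{p\in\mathcal{P}}\in(L_+^2[t_0,t_f])^{|\mathcal{P}|}$ with $\Psi_p(t,h)=D_p(t,h)+f(t+D_p(t,h)-T_A)$, where $f$ is a nonnegative arrival penalty function and $T_A$ is the desired arrival time (possibly depending on the O-D pair). Standing assumption: each $\Psi_p(\cdot,h)$ is measurable, positive almost everywhere and square integrable, and its essential infimum is positive. Define $$v_p(h)=\operatorname*{ess\,inf}_{t\in[t_0,t_f]}\Psi_p(t,h)>0,\qquad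 v_{ij}(h)=\min_{p\in\mathcal{P}_{ij}}v_p(h).$$ Definition (VT-BR-DUE: variable tolerance boundedly rational dynamic user equilibrium). $h^*\in\Lambda$ is a VT-BR-DUE associated with $\varepsilon(\cdot)$ if for all $(i,j)\in\mathcal{W}$ and $p\in\mathcal{P}_{ij}$, for almost every $t\in[t_0,t_f]$, $$h_p^*(t)>0\ \Longrightarrow\ \Psi_p(t,h^* )\in[v_{ij}(h^* ),\,v_{ij}(h^* )+\varepsilon_{ij}^p(h^* )].$$ *)

theory Defs
  imports "HOL-Analysis.Analysis" "HOL-Probability.Essential_Supremum"
begin

text \<open>
  Departure rate vectors and the values of the (effective) path delay operators assign a function
  of time to every path. Elements of \<open>L\<^sup>2[t\<^sub>0, t\<^sub>f]\<close> are represented by functions rather than by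
  equivalence classes modulo null sets, so pointwise conditions on them are imposed almost
  everywhere; values outside the time interval and on non-paths are irrelevant.
\<close>

type_synonym 'p path_fun = "'p \<Rightarrow> real \<Rightarrow> real"

abbreviation time_measure :: "real \<Rightarrow> real \<Rightarrow> real measure" where
  "time_measure t0 tf \<equiv> lebesgue_on {t0..tf}"

definition L2 :: "real \<Rightarrow> real \<Rightarrow> (real \<Rightarrow> real) set" where
  "L2 t0 tf = {g. g \<in> borel_measurable (time_measure t0 tf) \<and>
                  integrable (time_measure t0 tf) (\<lambda>t. (g t)\<^sup>2)}"

definition L2_nonneg :: "real \<Rightarrow> real \<Rightarrow> (real \<Rightarrow> real) set" where
  "L2_nonneg t0 tf = {g \<in> L2 t0 tf. AE t in time_measure t0 tf. 0 \<le> g t}"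

text \<open>
  The library provides only the essential supremum. The essential infimum is its dual, formed in
  the extended reals.
\<close>

definition ess_inf :: "'a measure \<Rightarrow> ('a \<Rightarrow> real) \<Rightarrow> ereal" where
  "ess_inf M g = - esssup M (\<lambda>x. - ereal (g x))"

text \<open>
  The disjoint decomposition of the path set \<open>P\<close> is encoded by the map \<open>od\<close> sending each
  path to the origin-destination pair it connects; its fibres in \<open>P\<close> are the sets \<open>P\<^sub>i\<^sub>j\<close>.
\<close>

definition paths_of :: "'p set \<Rightarrow> ('p \<Rightarrow> 'w) \<Rightarrow> 'w \<Rightarrow> 'p set" where
  "paths_of P od w = {p \<in> P. od p = w}"

definition feasible ::
  "real \<Rightarrow> real \<Rightarrow> 'w set \<Rightarrow> 'p set \<Rightarrow> ('p \<Rightarrow> 'w) \<Rightarrow> ('w \<Rightarrow> real) \<Rightarrow> 'p path_fun set" where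
  "feasible t0 tf W P od Q =
     {h. (\<forall>p\<in>P. h p \<in> L2_nonneg t0 tf) \<and>
         (\<forall>w\<in>W. (\<Sum>p\<in>paths_of P od w. (LINT t|time_measure t0 tf. h p t)) = Q w)}"

definition effective_delay ::
  "('p path_fun \<Rightarrow> 'p path_fun) \<Rightarrow> (real \<Rightarrow> real) \<Rightarrow> ('w \<Rightarrow> real) \<Rightarrow> ('p \<Rightarrow> 'w)
     \<Rightarrow> 'p path_fun \<Rightarrow> 'p path_fun" where
  "effective_delay D f TA od h p t = D h p t + f (t + D h p t - TA (od p))"

definition v_path ::
  "real \<Rightarrow> real \<Rightarrow> ('p path_fun \<Rightarrow> 'p path_fun) \<Rightarrow> 'p path_fun \<Rightarrow> 'p \<Rightarrow> real" where
  "v_path t0 tf \<Psi> h p = real_of_ereal (ess_inf (time_measure t0 tf) (\<Psi> h p))"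

definition v_od ::
  "real \<Rightarrow> real \<Rightarrow> 'p set \<Rightarrow> ('p \<Rightarrow> 'w) \<Rightarrow> ('p path_fun \<Rightarrow> 'p path_fun)
     \<Rightarrow> 'p path_fun \<Rightarrow> 'w \<Rightarrow> real" where
  "v_od t0 tf P od \<Psi> h w = (MIN p\<in>paths_of P od w. v_path t0 tf \<Psi> h p)"

text \<open>
  The tolerances \<open>\<epsilon>\<close> carry the path index only, since a path determines its
  origin-destination pair.
\<close>

definition VT_BR_DUE ::
  "real \<Rightarrow> real \<Rightarrow> 'w set \<Rightarrow> 'p set \<Rightarrow> ('p \<Rightarrow> 'w) \<Rightarrow> ('w \<Rightarrow> real)
     \<Rightarrow> ('p path_fun \<Rightarrow> 'p path_fun) \<Rightarrow> ('p path_fun \<Rightarrow> 'p \<Rightarrow> real) \<Rightarrow> 'p path_fun \<Rightarrow> bool" where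
  "VT_BR_DUE t0 tf W P od Q \<Psi> \<epsilon> h \<longleftrightarrow>
     h \<in> feasible t0 tf W P od Q \<and>
     (\<forall>w\<in>W. \<forall>p\<in>paths_of P od w. AE t in time_measure t0 tf.
        h p t > 0 \<longrightarrow>
        \<Psi> h p t \<in> {v_od t0 tf P od \<Psi> h w .. v_od t0 tf P od \<Psi> h w + \<epsilon> h p})"

definition \<Phi> ::
  "real \<Rightarrow> real \<Rightarrow> 'p set \<Rightarrow> ('p \<Rightarrow> 'w) \<Rightarrow> ('p path_fun \<Rightarrow> 'p path_fun)
     \<Rightarrow> ('p path_fun \<Rightarrow> 'p \<Rightarrow> real) \<Rightarrow> 'p path_fun \<Rightarrow> 'p path_fun" where
  "\<Phi> t0 tf P od \<Psi> \<epsilon> h p t =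
     max (\<Psi> h p t) (v_od t0 tf P od \<Psi> h (od p) + \<epsilon> h p)
     - (\<epsilon> h p - (MIN q\<in>paths_of P od (od p). \<epsilon> h q))"

end

theory Submission
  imports Defs
begin

text \<open>
  On the paths of an origin-destination pair \<open>w\<close> one has \<open>\<Phi> \<ge> v + e\<close>, where \<open>v\<close> is the least
  travel cost and \<open>e\<close> the least tolerance of \<open>w\<close>, with equality exactly where
  \<open>\<Psi> \<le> v + \<epsilon>\<close>. So \<open>h\<close> is an equilibrium iff it is supported where \<open>\<Phi>\<close> attains this lower
  bound, and then replacing \<open>\<Phi>\<close> by the constant \<open>v + e\<close>, against which all feasible flows have
  the same integral, yields the variational inequality. Conversely, the variational inequality is
  tested with the flow that sends the whole demand of \<open>w\<close> along a path of least cost, at times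
  where its cost is below \<open>v + \<delta>\<close>; letting \<open>\<delta> \<rightarrow> 0\<close> forces the total \<open>\<Phi>\<close>-cost of \<open>h\<close> down to
  its lower bound.
\<close>

section \<open>Essential infimum as the dual of the essential supremum\<close>

lemma ess_inf_AE: "AE x in M. ess_inf M g \<le> ereal (g x)"
proof -
  have "AE x in M. - ereal (g x) \<le> esssup M (\<lambda>x. - ereal (g x))"
    by (rule esssup_AE)
  then show ?thesis
    unfolding ess_inf_def by (auto simp: ereal_uminus_le_reorder)
qed

text \<open>Used in contrapositive form: any level above the essential infimum is undercut on a set
  of positive measure.\<close>

lemma ess_inf_geI:
  assumes "g \<in> borel_measurable M" and "AE x in M. c \<le> ereal (g x)"
  shows "c \<le> ess_inf M g"
proof -
  have "AE x in M. - ereal (g x) \<le> - c"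
    using assms(2) by eventually_elim (simp only: ereal_minus_le_minus)
  then have "esssup M (\<lambda>x. - ereal (g x)) \<le> - c"
    using assms(1) by (intro esssup_I) auto
  then show ?thesis
    unfolding ess_inf_def by (metis ereal_minus_le_minus ereal_uminus_uminus)
qed

text \<open>Excluding a null space rules out the value \<infinity>, and positivity rules out
  -\<infinity>; \<open>real_of_ereal\<close> would turn either into the default 0.\<close>

lemma ess_inf_eq_ereal:
  assumes "0 < ess_inf M g" and "\<not> (AE x in M. False)"
  shows "ess_inf M g = ereal (real_of_ereal (ess_inf M g))"
proof -
  have "ess_inf M g \<noteq> \<infinity>"
    using ess_inf_AE[of M g] assms(2) by auto
  then show ?thesis
    using assms(1) by (cases "ess_inf M g") auto
qed

section \<open>Square integrable functions on the time interval\<close>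

lemma L2_mult_integrable:
  assumes "g \<in> L2 t0 tf" and "h \<in> L2 t0 tf"
  shows "integrable (time_measure t0 tf) (\<lambda>t. g t * h t)"
proof (rule Bochner_Integration.integrable_bound)
  show "integrable (time_measure t0 tf) (\<lambda>t. (g t)\<^sup>2 + (h t)\<^sup>2)"
    using assms by (auto simp: L2_def)
  show "(\<lambda>t. g t * h t) \<in> borel_measurable (time_measure t0 tf)"
    using assms by (auto simp: L2_def)
  have "\<bar>x * y\<bar> \<le> x\<^sup>2 + y\<^sup>2" for x y :: real
  proof -
    have "2 * \<bar>x\<bar> * \<bar>y\<bar> \<le> x\<^sup>2 + y\<^sup>2"
      using sum_squares_bound[of "\<bar>x\<bar>" "\<bar>y\<bar>"] by simp
    moreover have "0 \<le> \<bar>x\<bar> * \<bar>y\<bar>" by simp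
    ultimately show ?thesis unfolding abs_mult by linarith
  qed
  then show "AE t in time_measure t0 tf. norm (g t * h t) \<le> norm ((g t)\<^sup>2 + (h t)\<^sup>2)"
    by simp
qed

lemma finite_time_measure: "finite_measure (time_measure t0 tf)"
  by (rule finite_measure_lebesgue_on) simp

lemma L2_bounded:
  assumes "g \<in> borel_measurable (time_measure t0 tf)" and "\<And>t. \<bar>g t\<bar> \<le> B"
  shows "g \<in> L2 t0 tf"
proof -
  have "\<bar>(g t)\<^sup>2\<bar> \<le> B\<^sup>2" for t
    using power_mono[OF assms(2)[of t], of 2] by simp
  then show ?thesis
    using assms(1) finite_measure.integrable_const_bound[OF finite_time_measure, of "\<lambda>t. (g t)\<^sup>2" "B\<^sup>2" t0 tf]
    by (auto simp: L2_def)
qed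

lemma L2_diff:
  assumes "g \<in> L2 t0 tf" and "h \<in> L2 t0 tf"
  shows "(\<lambda>t. g t - h t) \<in> L2 t0 tf"
proof -
  have "integrable (time_measure t0 tf) (\<lambda>t. (g t)\<^sup>2 - 2 * (g t * h t) + (h t)\<^sup>2)"
    using assms L2_mult_integrable[OF assms] by (auto simp: L2_def)
  moreover have "(\<lambda>t. (g t)\<^sup>2 - 2 * (g t * h t) + (h t)\<^sup>2) = (\<lambda>t. (g t - h t)\<^sup>2)"
    by (simp add: fun_eq_iff power2_eq_square algebra_simps)
  ultimately show ?thesis
    using assms by (auto simp: L2_def)
qed

lemma L2_max_const:
  assumes "g \<in> L2 t0 tf"
  shows "(\<lambda>t. max (g t) c) \<in> L2 t0 tf"
proof -
  have "integrable (time_measure t0 tf) (\<lambda>t. (max (g t) c)\<^sup>2)"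
  proof (rule Bochner_Integration.integrable_bound)
    show "integrable (time_measure t0 tf) (\<lambda>t. (g t)\<^sup>2 + c\<^sup>2)"
      using assms finite_measure.integrable_const[OF finite_time_measure] by (auto simp: L2_def)
    show "(\<lambda>t. (max (g t) c)\<^sup>2) \<in> borel_measurable (time_measure t0 tf)"
      using assms by (auto simp: L2_def)
  qed (auto simp: max_def)
  then show ?thesis
    using assms by (auto simp: L2_def)
qed

text \<open>The constant 1 is square integrable because the interval has finite measure, so this is
  the product lemma with second factor 1.\<close>

lemma L2_integrable: "g \<in> L2 t0 tf \<Longrightarrow> integrable (time_measure t0 tf) g"
  using L2_mult_integrable[of g t0 tf "\<lambda>_. 1"] L2_bounded[of "\<lambda>_. 1" t0 tf 1] by simp

lemma L2_nonneg_D: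
  assumes "g \<in> L2_nonneg t0 tf"
  shows "g \<in> L2 t0 tf" and "AE t in time_measure t0 tf. 0 \<le> g t"
  using assms by (auto simp: L2_nonneg_def)

section \<open>Integrability and lower bound of the modified delay\<close>

lemma \<Phi>_L2:
  assumes "\<Psi> h p \<in> L2 t0 tf"
  shows "\<Phi> t0 tf P od \<Psi> \<epsilon> h p \<in> L2 t0 tf"
proof -
  have "(\<lambda>_. \<epsilon> h p - (MIN q\<in>paths_of P od (od p). \<epsilon> h q)) \<in> L2 t0 tf"
    by (rule L2_bounded[OF _ order_refl]) simp
  from L2_diff[OF L2_max_const[OF assms] this] show ?thesis
    unfolding \<Phi>_def[abs_def] .
qed

text \<open>The maximum truncates at a threshold that varies with the path; subtracting the excess
  of \<open>\<epsilon> h p\<close> over the least tolerance brings all paths of \<open>w\<close> to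
  the same floor.\<close>

lemma \<Phi>_ge:
  assumes "od p = w"
  shows "v_od t0 tf P od \<Psi> h w + (MIN q\<in>paths_of P od w. \<epsilon> h q) \<le> \<Phi> t0 tf P od \<Psi> \<epsilon> h p t"
  using assms by (simp add: \<Phi>_def max_def)

lemma \<Phi>_eq_iff:
  assumes "od p = w"
  shows "\<Phi> t0 tf P od \<Psi> \<epsilon> h p t = v_od t0 tf P od \<Psi> h w + (MIN q\<in>paths_of P od w. \<epsilon> h q)
    \<longleftrightarrow> \<Psi> h p t \<le> v_od t0 tf P od \<Psi> h w + \<epsilon> h p"
  using assms by (auto simp: \<Phi>_def max_def)

lemma \<Phi>_diff_integrable:
  assumes "h \<in> feasible t0 tf W P od Q" and "g \<in> feasible t0 tf W P od Q"
    and "p \<in> P" and "\<Psi> h p \<in> L2 t0 tf"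
  shows "integrable (time_measure t0 tf) (\<lambda>t. \<Phi> t0 tf P od \<Psi> \<epsilon> h p t * (g p t - h p t))"
  using assms by (intro L2_mult_integrable \<Phi>_L2 L2_diff) (auto simp: feasible_def L2_nonneg_def)

section \<open>From equilibrium to the variational inequality\<close>

lemma VT_BR_DUE_imp_variational:
  assumes finite_W: "finite W"
    and finite_P: "finite P"
    and od_in_W: "\<And>p. p \<in> P \<Longrightarrow> od p \<in> W"
    and Psi_L2: "\<And>p. p \<in> P \<Longrightarrow> \<Psi> hs p \<in> L2 t0 tf"
    and due: "VT_BR_DUE t0 tf W P od Q \<Psi> \<epsilon> hs"
    and h: "h \<in> feasible t0 tf W P od Q"
  shows "0 \<le> (\<Sum>p\<in>P. (LINT t|time_measure t0 tf. \<Phi> t0 tf P od \<Psi> \<epsilon> hs p t * (h p t - hs p t)))"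
proof -
  let ?M = "time_measure t0 tf"
  let ?F = "\<Phi> t0 tf P od \<Psi> \<epsilon> hs"
  \<comment> \<open>The floor depends on \<open>w\<close> alone; this is what lets it be factored
    out of the sum over the paths of \<open>w\<close>.\<close>
  define c where "c w = v_od t0 tf P od \<Psi> hs w + (MIN q\<in>paths_of P od w. \<epsilon> hs q)" for w
  have hs: "hs \<in> feasible t0 tf W P od Q"
    using due by (simp add: VT_BR_DUE_def)
  have path: "c w * ((LINT t|?M. h p t) - (LINT t|?M. hs p t))
      \<le> (LINT t|?M. ?F p t * (h p t - hs p t))"
    if w: "w \<in> W" and p: "p \<in> paths_of P od w" for w p
  proof -
    have pP: "p \<in> P" and od_p: "od p = w"
      using p by (auto simp: paths_of_def)
    have L2: "h p \<in> L2_nonneg t0 tf" "hs p \<in> L2_nonneg t0 tf"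
      using h hs pP by (auto simp: feasible_def)
    have int: "integrable ?M (h p)" "integrable ?M (hs p)"
      using L2 by (auto simp: L2_nonneg_def intro: L2_integrable)
    have "AE t in ?M. hs p t > 0 \<longrightarrow> \<Psi> hs p t \<le> v_od t0 tf P od \<Psi> hs w + \<epsilon> hs p"
      using due w p by (auto simp: VT_BR_DUE_def elim!: eventually_mono)
    with L2_nonneg_D(2)[OF L2(1)] L2_nonneg_D(2)[OF L2(2)]
    have ae: "AE t in ?M. c w * (h p t - hs p t) \<le> ?F p t * (h p t - hs p t)"
    proof eventually_elim
      case (elim t)
      have ge: "c w \<le> ?F p t"
        unfolding c_def using od_p by (rule \<Phi>_ge)
      \<comment> \<open>Where \<open>hs\<close> sends flow, \<open>\<Phi>\<close> sits on its floor
        and both sides agree. Elsewhere the flow can only increase, so the larger factor gives the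
        larger product.\<close>
      show ?case
      proof (cases "hs p t > 0")
        case True
        then have "?F p t = c w"
          using elim unfolding c_def \<Phi>_eq_iff[of od p, OF od_p] by simp
        then show ?thesis by simp
      next
        case False
        then have "0 \<le> h p t - hs p t"
          using elim by simp
        then show ?thesis
          using ge by (rule mult_right_mono[rotated])
      qed
    qed
    have "c w * ((LINT t|?M. h p t) - (LINT t|?M. hs p t)) = (LINT t|?M. c w * (h p t - hs p t))"
      using int by simp
    also have "\<dots> \<le> (LINT t|?M. ?F p t * (h p t - hs p t))"
    proof (rule integral_mono_AE[OF _ _ ae])
      show "integrable ?M (\<lambda>t. c w * (h p t - hs p t))"
        using int by simp
      show "integrable ?M (\<lambda>t. ?F p t * (h p t - hs p t))"
        by (rule \<Phi>_diff_integrable[of hs t0 tf W P od Q h p \<Psi> \<epsilon>, OF hs h pP Psi_L2[OF pP]])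
    qed
    finally show ?thesis .
  qed
  have "0 \<le> (\<Sum>w\<in>W. \<Sum>p\<in>paths_of P od w. (LINT t|?M. ?F p t * (h p t - hs p t)))"
  proof (rule sum_nonneg)
    fix w assume w: "w \<in> W"
    \<comment> \<open>Both flows serve the demand \<open>Q w\<close>, so the total flow difference
      on \<open>w\<close> is zero, although single paths may differ.\<close>
    have "0 = (\<Sum>p\<in>paths_of P od w. c w * ((LINT t|?M. h p t) - (LINT t|?M. hs p t)))"
      using h hs w by (simp add: feasible_def sum_subtractf flip: sum_distrib_left)
    also have "(\<Sum>p\<in>paths_of P od w. c w * ((LINT t|?M. h p t) - (LINT t|?M. hs p t)))
        \<le> (\<Sum>p\<in>paths_of P od w. (LINT t|?M. ?F p t * (h p t - hs p t)))"
      by (rule sum_mono) (rule path[OF w])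
    finally show "0 \<le> (\<Sum>p\<in>paths_of P od w. (LINT t|?M. ?F p t * (h p t - hs p t)))" .
  qed
  also have "\<dots> = (\<Sum>p\<in>P. (LINT t|?M. ?F p t * (h p t - hs p t)))"
    unfolding paths_of_def using finite_P finite_W od_in_W by (intro sum.group) auto
  finally show ?thesis .
qed

section \<open>From the variational inequality to equilibrium\<close>

lemma variational_imp_VT_BR_DUE:
  assumes finite_P: "finite P"
    and paths_nonempty: "\<And>w. w \<in> W \<Longrightarrow> paths_of P od w \<noteq> {}"
    and Q_pos: "\<And>w. w \<in> W \<Longrightarrow> 0 < Q w"
    and Psi_L2: "\<And>p. p \<in> P \<Longrightarrow> \<Psi> hs p \<in> L2 t0 tf"
    and Psi_ess_inf: "\<And>p. p \<in> P \<Longrightarrow> 0 < ess_inf (time_measure t0 tf) (\<Psi> hs p)"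
    and eps_nonneg: "\<And>p. p \<in> P \<Longrightarrow> 0 \<le> \<epsilon> hs p"
    and hs: "hs \<in> feasible t0 tf W P od Q"
    and VI: "\<And>h. h \<in> feasible t0 tf W P od Q \<Longrightarrow>
      0 \<le> (\<Sum>p\<in>P. (LINT t|time_measure t0 tf. \<Phi> t0 tf P od \<Psi> \<epsilon> hs p t * (h p t - hs p t)))"
  shows "VT_BR_DUE t0 tf W P od Q \<Psi> \<epsilon> hs"
  unfolding VT_BR_DUE_def
proof (intro conjI ballI hs)
  let ?M = "time_measure t0 tf"
  let ?F = "\<Phi> t0 tf P od \<Psi> \<epsilon> hs"
  interpret finite_measure ?M by (rule finite_time_measure)
  fix w p assume w: "w \<in> W" and p: "p \<in> paths_of P od w"
  let ?Pw = "paths_of P od w"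
  define v where "v = v_od t0 tf P od \<Psi> hs w"
  define e where "e = (MIN q\<in>?Pw. \<epsilon> hs q)"
  have fin: "finite ?Pw" and sub: "?Pw \<subseteq> P"
    using finite_P by (auto simp: paths_of_def)
  have hsL: "hs r \<in> L2_nonneg t0 tf" if "r \<in> P" for r
    using hs that by (auto simp: feasible_def)
  have demand: "(\<Sum>r\<in>?Pw. (LINT t|?M. hs r t)) = Q w"
    using hs w by (auto simp: feasible_def)
  have int_hs: "integrable ?M (hs r)" if "r \<in> P" for r
    using L2_nonneg_D(1)[OF hsL[OF that]] by (rule L2_integrable)
  have F_L2: "?F r \<in> L2 t0 tf" if "r \<in> P" for r
    by (rule \<Phi>_L2[of \<Psi> hs r, OF Psi_L2[OF that]])
  have int_F_hs: "integrable ?M (\<lambda>t. ?F r t * hs r t)" if "r \<in> P" for r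
    using F_L2[OF that] L2_nonneg_D(1)[OF hsL[OF that]] by (rule L2_mult_integrable)
  \<comment> \<open>Positive demand excludes an interval of length zero: over a null space no flow
    has a nonzero integral.\<close>
  have nonnull: "\<not> (AE t in ?M. False)"
  proof
    assume "AE t in ?M. False"
    then have "(LINT t|?M. hs r t) = 0" for r
      by (intro integral_eq_zero_AE) (auto elim: eventually_mono)
    then show False
      using demand Q_pos[OF w] by simp
  qed
  have meas: "\<Psi> hs r \<in> borel_measurable ?M" if "r \<in> P" for r
    using Psi_L2[OF that] by (simp add: L2_def)
  have vp: "ess_inf ?M (\<Psi> hs r) = ereal (v_path t0 tf \<Psi> hs r)" if "r \<in> P" for r
    unfolding v_path_def using Psi_ess_inf[OF that] nonnull by (rule ess_inf_eq_ereal)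
  have v_le: "v \<le> v_path t0 tf \<Psi> hs r" if "r \<in> ?Pw" for r
    unfolding v_def v_od_def using fin that by simp
  \<comment> \<open>The minimum over finitely many paths is attained, which supplies the least-cost
    path \<open>q\<close> for the test flow.\<close>
  have "v \<in> v_path t0 tf \<Psi> hs ` ?Pw"
    unfolding v_def v_od_def by (rule Min_in) (simp_all add: fin paths_nonempty[OF w])
  then obtain q where q: "q \<in> ?Pw" and v_q: "v_path t0 tf \<Psi> hs q = v"
    by auto
  have qP: "q \<in> P" and od_q: "od q = w"
    using q by (auto simp: paths_of_def)
  have approx: "(\<Sum>r\<in>?Pw. (LINT t|?M. ?F r t * hs r t)) \<le> (v + e + \<delta>) * Q w" if \<delta>: "\<delta> > 0" for \<delta>
  proof -
    \<comment> \<open>Departure times at which \<open>q\<close> is within \<delta> of the least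
      cost. If \<open>A\<close> were null, \<open>v + \<delta>\<close> would be an essential lower
      bound, yet the essential infimum on \<open>q\<close> is \<open>v\<close>.\<close>
    define A where "A = {t \<in> space ?M. \<Psi> hs q t < v + \<delta>}"
    have A[measurable]: "A \<in> sets ?M"
      unfolding A_def using meas[OF qP] by measurable
    have "measure ?M A \<noteq> 0"
    proof
      assume "measure ?M A = 0"
      then have "A \<in> null_sets ?M"
        by (simp add: null_sets_def A emeasure_eq_measure)
      then have "AE t in ?M. t \<notin> A"
        by (rule AE_not_in)
      then have "AE t in ?M. ereal (v + \<delta>) \<le> ereal (\<Psi> hs q t)"
        using AE_space by eventually_elim (auto simp: A_def not_less)
      then have "ereal (v + \<delta>) \<le> ess_inf ?M (\<Psi> hs q)"
        by (rule ess_inf_geI[OF meas[OF qP]])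
      then show False
        using \<delta> vp[OF qP] v_q by simp
    qed
    then have A_pos: "measure ?M A > 0"
      by (simp add: zero_less_measure_iff)
    \<comment> \<open>The height is chosen so that the integral is \<open>Q w\<close>; being
      bounded, \<open>g\<close> is square integrable.\<close>
    define g where "g t = Q w / measure ?M A * indicat_real A t" for t
    have g_nonneg: "0 \<le> g t" for t
      using Q_pos[OF w] by (simp add: g_def)
    have g_L2: "g \<in> L2 t0 tf"
    proof (rule L2_bounded)
      show "\<bar>g t\<bar> \<le> Q w / measure ?M A" for t
        using Q_pos[OF w] by (auto simp: g_def indicator_def)
    qed (simp add: g_def[abs_def])
    have int_g: "(LINT t|?M. g t) = Q w"
    proof -
      have "A \<inter> {t0..tf} = A"
        by (auto simp: A_def)
      then show ?thesis
        using A_pos by (simp add: g_def[abs_def])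
    qed
    \<comment> \<open>Only the paths of \<open>w\<close> are changed, so in the variational
      inequality the terms of all other pairs vanish and the estimate is local to
      \<open>w\<close>.\<close>
    define h where "h r = (if r \<in> ?Pw then (if r = q then g else (\<lambda>_. 0)) else hs r)" for r
    have "h \<in> feasible t0 tf W P od Q"
      unfolding feasible_def
    proof (intro CollectI conjI ballI)
      fix r assume "r \<in> P"
      then show "h r \<in> L2_nonneg t0 tf"
        using hsL[of r] g_L2 g_nonneg L2_bounded[of "\<lambda>_. 0" t0 tf 0]
        by (auto simp: h_def L2_nonneg_def)
    next
      fix w' assume w': "w' \<in> W"
      show "(\<Sum>r\<in>paths_of P od w'. (LINT t|?M. h r t)) = Q w'"
      proof (cases "w' = w")
        case True
        have "(\<Sum>r\<in>?Pw. (LINT t|?M. h r t)) = (\<Sum>r\<in>?Pw. if r = q then Q w else 0)"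
          by (intro sum.cong) (auto simp: h_def int_g)
        then show ?thesis
          using True fin q by simp
      next
        case False
        then have "(\<Sum>r\<in>paths_of P od w'. (LINT t|?M. h r t))
            = (\<Sum>r\<in>paths_of P od w'. (LINT t|?M. hs r t))"
          by (intro sum.cong) (auto simp: h_def paths_of_def)
        then show ?thesis
          using hs w' by (auto simp: feasible_def)
      qed
    qed
    from VI[OF this] have "0 \<le> (\<Sum>r\<in>P. (LINT t|?M. ?F r t * (h r t - hs r t)))" .
    also have "\<dots> = (\<Sum>r\<in>?Pw. (LINT t|?M. ?F r t * (h r t - hs r t)))"
      using finite_P sub by (intro sum.mono_neutral_right) (auto simp: h_def)
    also have "\<dots> = (\<Sum>r\<in>?Pw. (if r = q then (LINT t|?M. ?F q t * g t) else 0)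
        - (LINT t|?M. ?F r t * hs r t))"
    proof (intro sum.cong refl)
      fix r assume r: "r \<in> ?Pw"
      then have rP: "r \<in> P" using sub by auto
      show "(LINT t|?M. ?F r t * (h r t - hs r t))
        = (if r = q then (LINT t|?M. ?F q t * g t) else 0) - (LINT t|?M. ?F r t * hs r t)"
        using r int_F_hs[OF rP] L2_mult_integrable[OF F_L2[OF qP] g_L2]
        by (auto simp: h_def right_diff_distrib)
    qed
    also have "\<dots> = (LINT t|?M. ?F q t * g t) - (\<Sum>r\<in>?Pw. (LINT t|?M. ?F r t * hs r t))"
      using fin q by (simp add: sum_subtractf)
    finally have "(\<Sum>r\<in>?Pw. (LINT t|?M. ?F r t * hs r t)) \<le> (LINT t|?M. ?F q t * g t)"
      by simp
    also have "\<dots> \<le> (LINT t|?M. (v + e + \<delta>) * g t)"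
    proof (intro integral_mono)
      show "integrable ?M (\<lambda>t. ?F q t * g t)"
        by (rule L2_mult_integrable[OF F_L2[OF qP] g_L2])
      show "integrable ?M (\<lambda>t. (v + e + \<delta>) * g t)"
        using L2_integrable[OF g_L2] by simp
      fix t
      show "?F q t * g t \<le> (v + e + \<delta>) * g t"
      \<comment> \<open>On \<open>A\<close>, nonnegativity of the tolerance bounds both arguments of
        the maximum by \<open>v + \<epsilon> hs q + \<delta>\<close>, and the correction term leaves
        \<open>v + e + \<delta>\<close>. Off \<open>A\<close> both sides are zero.\<close>
      proof (cases "t \<in> A")
        case True
        have "0 \<le> \<epsilon> hs q"
          by (rule eps_nonneg[OF qP])
        then have "?F q t \<le> v + e + \<delta>"
          using True \<delta> unfolding \<Phi>_def od_q by (simp add: A_def v_def e_def max_def)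
        then show ?thesis
          using g_nonneg by (rule mult_right_mono)
      qed (simp add: g_def)
    qed
    also have "\<dots> = (v + e + \<delta>) * Q w"
      using L2_integrable[OF g_L2] int_g by simp
    finally show ?thesis .
  qed
  have bound: "(\<Sum>r\<in>?Pw. (LINT t|?M. ?F r t * hs r t)) \<le> (v + e) * Q w"
  proof (rule field_le_epsilon)
    \<comment> \<open>The choice \<open>\<delta> = \<eta> / Q w\<close> cancels the factor
      \<open>Q w\<close> in the estimate.\<close>
    fix \<eta> :: real assume "\<eta> > 0"
    moreover have "(v + e + \<eta> / Q w) * Q w = (v + e) * Q w + \<eta>"
      using Q_pos[OF w] by (simp add: distrib_right)
    ultimately show "(\<Sum>r\<in>?Pw. (LINT t|?M. ?F r t * hs r t)) \<le> (v + e) * Q w + \<eta>"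
      using approx[of "\<eta> / Q w"] Q_pos[OF w] by simp
  qed
  \<comment> \<open>\<open>I r\<close> is the cost of the flow on \<open>r\<close> in excess of the
    floor. These excesses are nonnegative and their sum is at most zero, so each of them
    vanishes.\<close>
  define I where "I r = (LINT t|?M. (?F r t - (v + e)) * hs r t)" for r
  have AE_nonneg: "AE t in ?M. 0 \<le> (?F r t - (v + e)) * hs r t" if "r \<in> ?Pw" for r
  proof -
    have od_r: "od r = w" and rP: "r \<in> P"
      using that by (auto simp: paths_of_def)
    have "0 \<le> ?F r t - (v + e)" for t
      using \<Phi>_ge[of od r, OF od_r] by (simp add: v_def e_def)
    then show ?thesis
      using L2_nonneg_D(2)[OF hsL[OF rP]] by (auto elim!: eventually_mono)
  qed
  have I_eq: "I r = (LINT t|?M. ?F r t * hs r t) - (v + e) * (LINT t|?M. hs r t)" if "r \<in> ?Pw" for r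
    using int_hs[of r] int_F_hs[of r] that sub by (auto simp: I_def left_diff_distrib)
  have "(\<Sum>r\<in>?Pw. I r) \<le> 0"
    using bound by (simp add: I_eq sum_subtractf demand flip: sum_distrib_left)
  moreover have I_nonneg: "0 \<le> I r" if "r \<in> ?Pw" for r
    unfolding I_def using AE_nonneg[OF that] by (rule integral_nonneg_AE)
  ultimately have "(\<Sum>r\<in>?Pw. I r) = 0"
    by (meson order_antisym sum_nonneg)
  then have "I p = 0"
    using fin p I_nonneg by (simp add: sum_nonneg_eq_0_iff)
  have od_p: "od p = w" and pP: "p \<in> P"
    using p by (auto simp: paths_of_def)
  \<comment> \<open>A nonnegative integrand with zero integral vanishes almost everywhere, so
    positive flow forces \<open>\<Phi>\<close> onto its floor, which is the upper tolerance bound on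
    \<open>\<Psi>\<close>.\<close>
  have "AE t in ?M. (?F p t - (v + e)) * hs p t = 0"
  proof (subst integral_nonneg_eq_0_iff_AE[symmetric])
    show "integrable ?M (\<lambda>t. (?F p t - (v + e)) * hs p t)"
      using int_hs[OF pP] int_F_hs[OF pP] by (simp add: left_diff_distrib)
  qed (use AE_nonneg[OF p] \<open>I p = 0\<close> in \<open>auto simp: I_def\<close>)
  then show "AE t in ?M. 0 < hs p t \<longrightarrow>
      \<Psi> hs p t \<in> {v_od t0 tf P od \<Psi> hs w..v_od t0 tf P od \<Psi> hs w + \<epsilon> hs p}"
    \<comment> \<open>The lower bound holds whether or not there is flow: almost everywhere
      \<open>\<Psi> hs p\<close> is at least its essential infimum, hence at least
      \<open>v\<close>.\<close>
    using ess_inf_AE[of ?M "\<Psi> hs p"]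
  proof eventually_elim
    case (elim t)
    show ?case
    proof
      assume "0 < hs p t"
      then have "\<Psi> hs p t \<le> v + \<epsilon> hs p"
        using elim(1) \<Phi>_eq_iff[of od p, OF od_p] by (simp add: v_def e_def)
      moreover have "v \<le> \<Psi> hs p t"
        using elim(2) v_le[OF p] unfolding vp[OF pP] by simp
      ultimately show "\<Psi> hs p t \<in> {v_od t0 tf P od \<Psi> hs w..v_od t0 tf P od \<Psi> hs w + \<epsilon> hs p}"
        by (simp add: v_def)
    qed
  qed
qed

section \<open>Equivalence on the feasible set \<open>\<Lambda>\<close>\<close>

theorem theorem3p1:
  fixes t0 tf :: real
    and W :: "('v \<times> 'v) set"
    and P :: "'p set"
    and od :: "'p \<Rightarrow> 'v \<times> 'v"
    and Q TA :: "'v \<times> 'v \<Rightarrow> real"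
    and f :: "real \<Rightarrow> real"
    and D \<Psi> :: "'p path_fun \<Rightarrow> 'p path_fun"
    and \<epsilon> :: "'p path_fun \<Rightarrow> 'p \<Rightarrow> real"
    and \<Lambda> :: "'p path_fun set"
    and hs :: "'p path_fun"
  assumes interval: "t0 \<le> tf"
    and finite_W: "finite W"
    and finite_P: "finite P"
    and od_in_W: "\<And>p. p \<in> P \<Longrightarrow> od p \<in> W"
    and paths_nonempty: "\<And>w. w \<in> W \<Longrightarrow> paths_of P od w \<noteq> {}"
    and Q_pos: "\<And>w. w \<in> W \<Longrightarrow> 0 < Q w"
    and Lambda: "\<Lambda> = feasible t0 tf W P od Q"
    and D_L2: "\<And>h p. h \<in> \<Lambda> \<Longrightarrow> p \<in> P \<Longrightarrow> D h p \<in> L2_nonneg t0 tf"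
    and f_nonneg: "\<And>x. 0 \<le> f x"
    and Psi: "\<Psi> = effective_delay D f TA od"
    and Psi_L2: "\<And>h p. h \<in> \<Lambda> \<Longrightarrow> p \<in> P \<Longrightarrow> \<Psi> h p \<in> L2 t0 tf"
    and Psi_pos: "\<And>h p. h \<in> \<Lambda> \<Longrightarrow> p \<in> P \<Longrightarrow> AE t in time_measure t0 tf. 0 < \<Psi> h p t"
    and Psi_ess_inf: "\<And>h p. h \<in> \<Lambda> \<Longrightarrow> p \<in> P \<Longrightarrow> 0 < ess_inf (time_measure t0 tf) (\<Psi> h p)"
    and eps_nonneg: "\<And>h p. h \<in> \<Lambda> \<Longrightarrow> p \<in> P \<Longrightarrow> 0 \<le> \<epsilon> h p"
    and hs: "hs \<in> \<Lambda>"
  shows "VT_BR_DUE t0 tf W P od Q \<Psi> \<epsilon> hs \<longleftrightarrow>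
    (\<forall>h\<in>\<Lambda>. 0 \<le> (\<Sum>p\<in>P. (LINT t|time_measure t0 tf. \<Phi> t0 tf P od \<Psi> \<epsilon> hs p t * (h p t - hs p t))))"
proof
  assume due: "VT_BR_DUE t0 tf W P od Q \<Psi> \<epsilon> hs"
  show "\<forall>h\<in>\<Lambda>. 0 \<le> (\<Sum>p\<in>P. (LINT t|time_measure t0 tf.
      \<Phi> t0 tf P od \<Psi> \<epsilon> hs p t * (h p t - hs p t)))"
  proof
    fix h assume "h \<in> \<Lambda>"
    then have "h \<in> feasible t0 tf W P od Q"
      by (simp only: Lambda)
    from finite_W finite_P od_in_W Psi_L2[OF hs] due this
    show "0 \<le> (\<Sum>p\<in>P. (LINT t|time_measure t0 tf.
        \<Phi> t0 tf P od \<Psi> \<epsilon> hs p t * (h p t - hs p t)))"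
      by (rule VT_BR_DUE_imp_variational)
  qed
next
  assume VI: "\<forall>h\<in>\<Lambda>. 0 \<le> (\<Sum>p\<in>P. (LINT t|time_measure t0 tf.
      \<Phi> t0 tf P od \<Psi> \<epsilon> hs p t * (h p t - hs p t)))"
  from hs have "hs \<in> feasible t0 tf W P od Q"
    by (simp only: Lambda)
  from finite_P paths_nonempty Q_pos Psi_L2[OF hs] Psi_ess_inf[OF hs] eps_nonneg[OF hs] this
    VI[unfolded Lambda, rule_format]
  show "VT_BR_DUE t0 tf W P od Q \<Psi> \<epsilon> hs"
    by (rule variational_imp_VT_BR_DUE)
qed

end
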